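(* Let $X$, $Y$ be Polish spaces, $c:X\times Y\to\mathbb{R}$ a Borel cost function uniformly bounded below, $\mu\in\mathscr{P}(X)$ and $\nu\in\mathscr{P}(Y)$. Consider the problems of finding $\phi:X\to\mathbb{R}$, resp. $\psi:Y\to\mathbb{R}$, such that $$\text{(K}^-)\quad \int_YT^-\phi\,d\nu=\inf_{\pi\in\Gamma(\mu,\nu)}\int_{X\times Y}\big(\phi(x)+c(x,y)\big)\,d\pi,$$ $$\text{(K}^+)\quad \int_XT^+\psi\,d\mu=\sup_{\pi\in\Gamma(\mu,\nu)}\int_{X\times Y}\big(\psi(y)-c(x,y)\big)\,d\pi.$$ (1) If $\phi:X\to\mathbb{R}$ is a solution of (K$^-$), then $(\phi,T^-\phi)\in I_c$ is a solution of the Kantorovich-Rubinstein problem (KR). Conversely, if $(\phi,\psi)\in I_c$ is a solution of (KR), then $\phi$ solves (K$^-$). (2) If $\psi:Y\to\mathbb{R}$ is a solution of (K$^+$), then $(T^+\psi,\psi)\in I_c$ is a solution of (KR). Conversely, if $(\phi,\psi)\in I_c$ is a solution of (KR), then $\psi$ solves (K$^+$).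
   Context: $\mathscr{P}(X)$ is the set of Borel probability measures on $X$. $\Gamma(\mu,\nu)$ is the set of transport plans, i.e. $\pi\in\mathscr{P}(X\times Y)$ with marginals $\mu$ and $\nu$. Lax-Oleinik operators: $T^-\phi(y):=\inf_{x\in X}\{\phi(x)+c(x,y)\}$, $T^+\psi(x):=\sup_{y\in Y}\{\psi(y)-c(x,y)\}$; standing assumption: the infimum and supremum are attained. $\mathcal{C}(\mu,\nu):=\inf\{\int_{X\times Y}c\,d\pi:\ \pi\in\Gamma(\mu,\nu)\}$ and $I_c:=\{(\phi,\psi):\ \psi(y)-\phi(x)\le c(x,y)\ \text{for all}\ x\in X,\ y\in Y\}$. The Kantorovich-Rubinstein duality (KR) is $\mathcal{C}(\mu,\nu)=\sup_{(\phi,\psi)\in I_c}\{\int_Y\psi\,d\nu-\int_X\phi\,d\mu\}$; a pair $(\phi,\psi)\in I_c$ is a solution of (KR) if it attains this supremum, i.e. $\int_Y\psi\,d\nu-\int_X\phi\,d\mu=\mathcal{C}(\mu,\nu)$. Convention: the functions $\phi,\psi,T^-\phi,T^+\psi$ whose integrals occur are measurable and integrable with respect to the corresponding measure $\mu$ or $\nu$. *)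

theory Defs
  imports "HOL-Probability.Probability"
begin

text \<open>Integral of a real function with values in the extended reals. It is only used for Borel
  functions whose negative part, or whose positive part, is integrable (such as
  \<open>c\<close>, \<open>\<phi> + c\<close> and \<open>\<psi> - c\<close>
  with \<open>c\<close> bounded below and \<open>\<phi>\<close>, \<open>\<psi>\<close> integrable), so that
  \<open>\<infinity> - \<infinity>\<close> does not occur. Here \<open>ennreal r = 0\<close> for
  \<open>r \<le> 0\<close>.\<close>

definition ext_integral :: "'a measure \<Rightarrow> ('a \<Rightarrow> real) \<Rightarrow> ereal" where
  "ext_integral M f =
     enn2ereal (\<integral>\<^sup>+ z. ennreal (f z) \<partial>M) - enn2ereal (\<integral>\<^sup>+ z. ennreal (- f z) \<partial>M)"

definition transport_plans ::
  "'a::polish_space measure \<Rightarrow> 'b::polish_space measure \<Rightarrow> ('a \<times> 'b) measure set" where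
  "transport_plans \<mu> \<nu> =
     {\<pi>. prob_space \<pi> \<and> sets \<pi> = sets borel \<and> distr \<pi> borel fst = \<mu> \<and> distr \<pi> borel snd = \<nu>}"

text \<open>The Lax-Oleinik operators. The real \<open>INF\<close> and \<open>SUP\<close> are unspecified
  on unbounded sets; they are used only under the attainment conditions below.\<close>

definition T_minus :: "('a \<times> 'b \<Rightarrow> real) \<Rightarrow> ('a \<Rightarrow> real) \<Rightarrow> 'b \<Rightarrow> real" where
  "T_minus c \<phi> y = (INF x. \<phi> x + c (x, y))"

definition T_plus :: "('a \<times> 'b \<Rightarrow> real) \<Rightarrow> ('b \<Rightarrow> real) \<Rightarrow> 'a \<Rightarrow> real" where
  "T_plus c \<psi> x = (SUP y. \<psi> y - c (x, y))"

definition T_minus_attained :: "('a \<times> 'b \<Rightarrow> real) \<Rightarrow> ('a \<Rightarrow> real) \<Rightarrow> bool" where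
  "T_minus_attained c \<phi> \<longleftrightarrow> (\<forall>y. \<exists>x. \<forall>x'. \<phi> x + c (x, y) \<le> \<phi> x' + c (x', y))"

definition T_plus_attained :: "('a \<times> 'b \<Rightarrow> real) \<Rightarrow> ('b \<Rightarrow> real) \<Rightarrow> bool" where
  "T_plus_attained c \<psi> \<longleftrightarrow> (\<forall>x. \<exists>y. \<forall>y'. \<psi> y' - c (x, y') \<le> \<psi> y - c (x, y))"

definition transport_cost ::
  "('a::polish_space \<times> 'b::polish_space \<Rightarrow> real) \<Rightarrow> 'a measure \<Rightarrow> 'b measure \<Rightarrow> ereal" where
  "transport_cost c \<mu> \<nu> = (INF \<pi>\<in>transport_plans \<mu> \<nu>. ext_integral \<pi> c)"

definition I_c :: "('a \<times> 'b \<Rightarrow> real) \<Rightarrow> (('a \<Rightarrow> real) \<times> ('b \<Rightarrow> real)) set" where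
  "I_c c = {(\<phi>, \<psi>). \<forall>x y. \<psi> y - \<phi> x \<le> c (x, y)}"

definition KR_supremum ::
  "('a \<times> 'b \<Rightarrow> real) \<Rightarrow> 'a measure \<Rightarrow> 'b measure \<Rightarrow> ereal" where
  "KR_supremum c \<mu> \<nu> =
     (SUP (\<phi>, \<psi>) \<in> {(\<phi>, \<psi>) \<in> I_c c. integrable \<mu> \<phi> \<and> integrable \<nu> \<psi>}.
        ereal ((\<integral>y. \<psi> y \<partial>\<nu>) - (\<integral>x. \<phi> x \<partial>\<mu>)))"

text \<open>A solution attains the supremum, with value equal to the optimal transport cost.
  In the setting of the theorem weak duality makes this equivalent to the value being the
  transport cost, so no duality theorem is presupposed.\<close>

definition solves_KR ::
  "('a::polish_space \<times> 'b::polish_space \<Rightarrow> real) \<Rightarrow> 'a measure \<Rightarrow> 'b measure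
     \<Rightarrow> ('a \<Rightarrow> real) \<Rightarrow> ('b \<Rightarrow> real) \<Rightarrow> bool" where
  "solves_KR c \<mu> \<nu> \<phi> \<psi> \<longleftrightarrow>
     (\<phi>, \<psi>) \<in> I_c c \<and> integrable \<mu> \<phi> \<and> integrable \<nu> \<psi> \<and>
     ereal ((\<integral>y. \<psi> y \<partial>\<nu>) - (\<integral>x. \<phi> x \<partial>\<mu>)) = KR_supremum c \<mu> \<nu> \<and>
     KR_supremum c \<mu> \<nu> = transport_cost c \<mu> \<nu>"

definition solves_K_minus ::
  "('a::polish_space \<times> 'b::polish_space \<Rightarrow> real) \<Rightarrow> 'a measure \<Rightarrow> 'b measure
     \<Rightarrow> ('a \<Rightarrow> real) \<Rightarrow> bool" where
  "solves_K_minus c \<mu> \<nu> \<phi> \<longleftrightarrow>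
     ereal (\<integral>y. T_minus c \<phi> y \<partial>\<nu>) =
       (INF \<pi>\<in>transport_plans \<mu> \<nu>. ext_integral \<pi> (\<lambda>(x, y). \<phi> x + c (x, y)))"

definition solves_K_plus ::
  "('a::polish_space \<times> 'b::polish_space \<Rightarrow> real) \<Rightarrow> 'a measure \<Rightarrow> 'b measure
     \<Rightarrow> ('b \<Rightarrow> real) \<Rightarrow> bool" where
  "solves_K_plus c \<mu> \<nu> \<psi> \<longleftrightarrow>
     ereal (\<integral>x. T_plus c \<psi> x \<partial>\<mu>) =
       (SUP \<pi>\<in>transport_plans \<mu> \<nu>. ext_integral \<pi> (\<lambda>(x, y). \<psi> y - c (x, y)))"

end

theory Submission imports Defs begin

text \<open>Integrating against a plan splits off the marginal integrals, so (K\<open>\<^sup>-\<close>) says exactly that the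
  pair \<open>(\<phi>, T\<^sup>- \<phi>)\<close> has dual value equal to the transport cost, and similarly (K\<open>\<^sup>+\<close>) for
  \<open>(T\<^sup>+ \<psi>, \<psi>)\<close>. By weak duality an admissible pair solves (KR) iff its dual value is the
  transport cost, and replacing \<open>\<psi>\<close> by \<open>T\<^sup>- \<phi>\<close> (or \<open>\<phi>\<close> by \<open>T\<^sup>+ \<psi>\<close>) keeps a pair admissible
  without lowering its dual value.\<close>

section \<open>Integrals with values in the extended reals\<close>

lemma ext_integral_eq_integral:
  assumes "integrable M f"
  shows "ext_integral M f = ereal (\<integral>z. f z \<partial>M)"
proof -
  have fin: "(\<integral>\<^sup>+ z. ennreal (f z) \<partial>M) \<noteq> \<infinity>" "(\<integral>\<^sup>+ z. ennreal (- f z) \<partial>M) \<noteq> \<infinity>"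
    using assms by (auto simp: real_integrable_def)
  have enn: "enn2ereal x = ereal (enn2real x)" if "x \<noteq> \<infinity>" for x
    using that by (cases x) auto
  show ?thesis
    unfolding ext_integral_def real_lebesgue_integral_def[OF assms]
    by (simp only: enn[OF fin(1)] enn[OF fin(2)] ereal_minus(1))
qed

lemma ext_integral_mono:
  assumes "\<And>z. z \<in> space M \<Longrightarrow> f z \<le> g z"
  shows "ext_integral M f \<le> ext_integral M g"
  unfolding ext_integral_def
  by (intro ereal_minus_mono)
    (auto simp flip: less_eq_ennreal.rep_eq intro!: nn_integral_mono ennreal_leI assms)

text \<open>Negation swaps the two parts. If both were infinite, \<open>ereal\<close> subtraction
  would give \<infinity> for \<open>f\<close> and for \<open>- f\<close> alike, so one part has to
  be finite.\<close>

lemma ext_integral_uminus: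
  assumes "(\<integral>\<^sup>+ z. ennreal (- f z) \<partial>M) \<noteq> \<infinity>"
  shows "ext_integral M (\<lambda>z. - f z) = - ext_integral M f"
  using assms unfolding ext_integral_def
  by (cases "\<integral>\<^sup>+ z. ennreal (f z) \<partial>M"; cases "\<integral>\<^sup>+ z. ennreal (- f z) \<partial>M") auto

text \<open>Beyond the integrable case, finiteness of the negative part of \<open>f\<close> leaves
  only an infinite positive part, and then both sides are \<infinity>.\<close>

lemma ext_integral_add:
  assumes g: "integrable M g" and f [measurable]: "f \<in> borel_measurable M"
    and neg: "(\<integral>\<^sup>+ z. ennreal (- f z) \<partial>M) \<noteq> \<infinity>"
  shows "ext_integral M (\<lambda>z. g z + f z) = ereal (\<integral>z. g z \<partial>M) + ext_integral M f"
proof (cases "integrable M f")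
  case True
  then show ?thesis using g by (simp add: ext_integral_eq_integral)
next
  case False
  have gm [measurable]: "g \<in> borel_measurable M" using g by auto
  have gfin: "(\<integral>\<^sup>+ z. ennreal (- g z) \<partial>M) \<noteq> \<infinity>" using g by (auto simp: real_integrable_def)
  have finf: "(\<integral>\<^sup>+ z. ennreal (f z) \<partial>M) = \<infinity>"
    using False neg f by (auto simp: real_integrable_def)
  \<comment> \<open>As \<open>b = (a + b) + (- a)\<close>, subadditivity of the positive part
    carries the infinite positive part of \<open>f\<close> over to \<open>g + f\<close>, because
    \<open>- g\<close> contributes only a finite amount.\<close>
  have enn: "ennreal b \<le> ennreal (a + b) + ennreal (- a)" for a b
    by (auto simp: ennreal_plus_if intro: ennreal_leI)
  have "(\<integral>\<^sup>+ z. ennreal (f z) \<partial>M) \<le> (\<integral>\<^sup>+ z. ennreal (g z + f z) + ennreal (- g z) \<partial>M)"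
    by (intro nn_integral_mono enn)
  also have "\<dots> = (\<integral>\<^sup>+ z. ennreal (g z + f z) \<partial>M) + (\<integral>\<^sup>+ z. ennreal (- g z) \<partial>M)"
    by (rule nn_integral_add) auto
  finally have sinf: "(\<integral>\<^sup>+ z. ennreal (g z + f z) \<partial>M) = \<infinity>"
    using finf gfin by (auto simp: top_unique)
  have "(\<integral>\<^sup>+ z. ennreal (- (g z + f z)) \<partial>M) \<le> (\<integral>\<^sup>+ z. ennreal (- g z) + ennreal (- f z) \<partial>M)"
    by (intro nn_integral_mono) (auto simp: ennreal_plus_if intro: ennreal_leI)
  also have "\<dots> = (\<integral>\<^sup>+ z. ennreal (- g z) \<partial>M) + (\<integral>\<^sup>+ z. ennreal (- f z) \<partial>M)"
    by (rule nn_integral_add) auto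
  finally have sneg: "(\<integral>\<^sup>+ z. ennreal (- (g z + f z)) \<partial>M) \<noteq> \<infinity>"
    using gfin neg by (auto simp: top_unique)
  have top: "enn2ereal \<infinity> - enn2ereal x = \<infinity>" if "x \<noteq> \<infinity>" for x
    using that by (cases x) auto
  show ?thesis
    unfolding ext_integral_def by (simp only: finf sinf top[OF neg] top[OF sneg]) simp
qed

lemma nn_integral_uminus_bounded_below:
  fixes f :: "'a \<Rightarrow> real"
  assumes "finite_measure M" and "\<And>z. K \<le> f z"
  shows "(\<integral>\<^sup>+ z. ennreal (- f z) \<partial>M) \<noteq> \<infinity>"
proof -
  interpret finite_measure M by fact
  have "(\<integral>\<^sup>+ z. ennreal (- f z) \<partial>M) \<le> (\<integral>\<^sup>+ z. ennreal (- K) \<partial>M)"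
    by (intro nn_integral_mono ennreal_leI) (simp add: assms(2))
  also have "\<dots> < \<infinity>"
    by (simp add: ennreal_mult_eq_top_iff less_top[symmetric])
  finally show ?thesis by simp
qed

section \<open>Marginals of transport plans\<close>

lemma transport_plan_fst:
  fixes \<phi> :: "'a::polish_space \<Rightarrow> real"
  assumes "\<pi> \<in> transport_plans \<mu> \<nu>" and "integrable \<mu> \<phi>"
  shows "integrable \<pi> (\<lambda>z. \<phi> (fst z))" and "(\<integral>z. \<phi> (fst z) \<partial>\<pi>) = (\<integral>x. \<phi> x \<partial>\<mu>)"
proof -
  have \<pi>: "sets \<pi> = sets borel" "\<mu> = distr \<pi> borel fst"
    using assms(1) by (auto simp: transport_plans_def)
  have m: "fst \<in> measurable \<pi> borel"
    unfolding measurable_cong_sets[OF \<pi>(1) refl]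
    by (intro borel_measurable_continuous_onI continuous_on_fst continuous_on_id)
  \<comment> \<open>A pushforward into \<open>borel\<close> carries the Borel sets, so integrability
    already makes \<phi> Borel, as the change of variables requires.\<close>
  have \<phi>: "\<phi> \<in> borel_measurable borel"
    using assms(2) borel_measurable_integrable \<pi>(2) by fastforce
  show "integrable \<pi> (\<lambda>z. \<phi> (fst z))"
    using assms(2) unfolding \<pi>(2) integrable_distr_eq[OF m \<phi>] .
  show "(\<integral>z. \<phi> (fst z) \<partial>\<pi>) = (\<integral>x. \<phi> x \<partial>\<mu>)"
    unfolding \<pi>(2) by (rule integral_distr[OF m \<phi>, symmetric])
qed

lemma transport_plan_snd:
  fixes \<psi> :: "'b::polish_space \<Rightarrow> real"
  assumes "\<pi> \<in> transport_plans \<mu> \<nu>" and "integrable \<nu> \<psi>"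
  shows "integrable \<pi> (\<lambda>z. \<psi> (snd z))" and "(\<integral>z. \<psi> (snd z) \<partial>\<pi>) = (\<integral>y. \<psi> y \<partial>\<nu>)"
proof -
  have \<pi>: "sets \<pi> = sets borel" "\<nu> = distr \<pi> borel snd"
    using assms(1) by (auto simp: transport_plans_def)
  have m: "snd \<in> measurable \<pi> borel"
    unfolding measurable_cong_sets[OF \<pi>(1) refl]
    by (intro borel_measurable_continuous_onI continuous_on_snd continuous_on_id)
  have \<psi>: "\<psi> \<in> borel_measurable borel"
    using assms(2) borel_measurable_integrable \<pi>(2) by fastforce
  show "integrable \<pi> (\<lambda>z. \<psi> (snd z))"
    using assms(2) unfolding \<pi>(2) integrable_distr_eq[OF m \<psi>] .
  show "(\<integral>z. \<psi> (snd z) \<partial>\<pi>) = (\<integral>y. \<psi> y \<partial>\<nu>)"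
    unfolding \<pi>(2) by (rule integral_distr[OF m \<psi>, symmetric])
qed

section \<open>Lax-Oleinik operators and admissible pairs\<close>

lemma T_minus_le:
  assumes "T_minus_attained c \<phi>"
  shows "T_minus c \<phi> y \<le> \<phi> x + c (x, y)"
  using assms unfolding T_minus_def T_minus_attained_def
  \<comment> \<open>The value at a minimiser bounds the set below, so the real \<open>INF\<close> is
    a genuine infimum.\<close>
  by (intro cINF_lower) (auto simp: bdd_below_def)

lemma T_plus_ge:
  assumes "T_plus_attained c \<psi>"
  shows "\<psi> y - c (x, y) \<le> T_plus c \<psi> x"
  using assms unfolding T_plus_def T_plus_attained_def
  by (intro cSUP_upper) (auto simp: bdd_above_def)

lemma T_minus_in_I_c: "T_minus_attained c \<phi> \<Longrightarrow> (\<phi>, T_minus c \<phi>) \<in> I_c c"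
  using T_minus_le[of c \<phi>] by (simp add: I_c_def algebra_simps)

lemma T_plus_in_I_c: "T_plus_attained c \<psi> \<Longrightarrow> (T_plus c \<psi>, \<psi>) \<in> I_c c"
  using T_plus_ge[of c \<psi>] by (simp add: I_c_def algebra_simps)

text \<open>Admissibility makes \<open>\<psi> y\<close> a lower bound of the set defining
  \<open>T_minus c \<phi> y\<close>. Under attainment \<open>T_minus c \<phi>\<close> is thus the
  largest partner of \<phi>.\<close>

lemma I_c_le_T_minus: "(\<phi>, \<psi>) \<in> I_c c \<Longrightarrow> \<psi> y \<le> T_minus c \<phi> y"
  unfolding T_minus_def I_c_def by (intro cINF_greatest) (auto simp: algebra_simps)

lemma I_c_ge_T_plus: "(\<phi>, \<psi>) \<in> I_c c \<Longrightarrow> T_plus c \<psi> x \<le> \<phi> x"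
  unfolding T_plus_def I_c_def by (intro cSUP_least) (auto simp: algebra_simps)

text \<open>Integrate the constraint of \<open>I_c\<close> against an arbitrary plan; the marginals
  turn its left side into the dual value.\<close>

lemma weak_duality:
  assumes "(\<phi>, \<psi>) \<in> I_c c" "integrable \<mu> \<phi>" "integrable \<nu> \<psi>"
  shows "ereal ((\<integral>y. \<psi> y \<partial>\<nu>) - (\<integral>x. \<phi> x \<partial>\<mu>)) \<le> transport_cost c \<mu> \<nu>"
  unfolding transport_cost_def
proof (rule INF_greatest)
  fix \<pi> assume \<pi>: "\<pi> \<in> transport_plans \<mu> \<nu>"
  note p = transport_plan_fst[OF \<pi> assms(2)] transport_plan_snd[OF \<pi> assms(3)]
  have "ereal ((\<integral>y. \<psi> y \<partial>\<nu>) - (\<integral>x. \<phi> x \<partial>\<mu>)) = ext_integral \<pi> (\<lambda>z. \<psi> (snd z) - \<phi> (fst z))"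
    using p by (simp add: ext_integral_eq_integral)
  also have "\<dots> \<le> ext_integral \<pi> c"
    using assms(1) by (intro ext_integral_mono) (auto simp: I_c_def)
  finally show "ereal ((\<integral>y. \<psi> y \<partial>\<nu>) - (\<integral>x. \<phi> x \<partial>\<mu>)) \<le> ext_integral \<pi> c" .
qed

text \<open>\<open>KR_supremum\<close> lies between the dual value of an admissible pair and the
  transport cost, so the two equations in \<open>solves_KR\<close> collapse into one.\<close>

lemma solves_KR_iff:
  "solves_KR c \<mu> \<nu> \<phi> \<psi> \<longleftrightarrow> (\<phi>, \<psi>) \<in> I_c c \<and> integrable \<mu> \<phi> \<and> integrable \<nu> \<psi> \<and>
     ereal ((\<integral>y. \<psi> y \<partial>\<nu>) - (\<integral>x. \<phi> x \<partial>\<mu>)) = transport_cost c \<mu> \<nu>"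
proof (cases "(\<phi>, \<psi>) \<in> I_c c \<and> integrable \<mu> \<phi> \<and> integrable \<nu> \<psi>")
  case True
  have "ereal ((\<integral>y. \<psi> y \<partial>\<nu>) - (\<integral>x. \<phi> x \<partial>\<mu>)) \<le> KR_supremum c \<mu> \<nu>"
    unfolding KR_supremum_def using True by (intro SUP_upper2[of "(\<phi>, \<psi>)"]) auto
  moreover have "KR_supremum c \<mu> \<nu> \<le> transport_cost c \<mu> \<nu>"
    unfolding KR_supremum_def by (intro SUP_least) (auto intro: weak_duality)
  ultimately show ?thesis
    unfolding solves_KR_def using True by auto
qed (auto simp: solves_KR_def)

text \<open>Adding a real constant is an order automorphism of \<open>ereal\<close>, with inverse
  the addition of \<open>- r\<close>. This covers infinite values and an empty index set.\<close>

lemma INF_ereal_const_add: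
  "(INF i\<in>I. ereal r + f i) = ereal r + (INF i\<in>I. f i)"
proof (rule antisym)
  have eq: "ereal r + (ereal (- r) + x) = x" for x by (cases x) auto
  have "(INF i\<in>I. ereal r + f i) = ereal r + (ereal (- r) + (INF i\<in>I. ereal r + f i))"
    by (simp only: eq)
  also have "\<dots> \<le> ereal r + (INF i\<in>I. f i)"
  proof (intro add_left_mono INF_greatest)
    fix i assume "i \<in> I"
    then have "ereal (- r) + (INF i\<in>I. ereal r + f i) \<le> ereal (- r) + (ereal r + f i)"
      by (intro add_left_mono INF_lower)
    also have "\<dots> = f i" by (cases "f i") auto
    finally show "ereal (- r) + (INF i\<in>I. ereal r + f i) \<le> f i" .
  qed
  finally show "(INF i\<in>I. ereal r + f i) \<le> ereal r + (INF i\<in>I. f i)" .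
  show "ereal r + (INF i\<in>I. f i) \<le> (INF i\<in>I. ereal r + f i)"
    by (intro INF_greatest add_left_mono INF_lower)
qed

text \<open>An infinite \<open>x\<close> makes both sides false, so finiteness of the transport cost
  need not be known beforehand.\<close>

lemma ereal_diff_eq_iff: "ereal a = ereal b + x \<longleftrightarrow> ereal (a - b) = x"
  by (cases x) auto

lemma ereal_eq_diff_iff: "ereal a = ereal b - x \<longleftrightarrow> ereal (b - a) = x"
  by (cases x) auto

section \<open>(K^-) and (K^+) as conditions on the dual value\<close>

context
  fixes c :: "'a::polish_space \<times> 'b::polish_space \<Rightarrow> real" and K :: real
  assumes c_borel: "c \<in> borel_measurable borel" and c_ge: "\<And>z. K \<le> c z"
begin

lemma transport_plan_cost:
  assumes "\<pi> \<in> transport_plans \<mu> \<nu>"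
  shows "c \<in> borel_measurable \<pi>" and "(\<integral>\<^sup>+ z. ennreal (- c z) \<partial>\<pi>) \<noteq> \<infinity>"
proof -
  have "sets \<pi> = sets borel" and fin: "finite_measure \<pi>"
    using assms by (auto simp: transport_plans_def prob_space_def)
  then show "c \<in> borel_measurable \<pi>"
    using c_borel measurable_cong_sets[of \<pi> borel borel borel] by auto
  show "(\<integral>\<^sup>+ z. ennreal (- c z) \<partial>\<pi>) \<noteq> \<infinity>"
    using fin c_ge by (rule nn_integral_uminus_bounded_below)
qed

text \<open>Every plan gives \<phi> the same integral, which leaves the infimum as a real constant
  and moves to the other side.\<close>

lemma solves_K_minus_iff:
  assumes "integrable \<mu> \<phi>"
  shows "solves_K_minus c \<mu> \<nu> \<phi> \<longleftrightarrow>
    ereal ((\<integral>y. T_minus c \<phi> y \<partial>\<nu>) - (\<integral>x. \<phi> x \<partial>\<mu>)) = transport_cost c \<mu> \<nu>"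
proof -
  have "ext_integral \<pi> (\<lambda>(x, y). \<phi> x + c (x, y)) = ereal (\<integral>x. \<phi> x \<partial>\<mu>) + ext_integral \<pi> c"
    if \<pi>: "\<pi> \<in> transport_plans \<mu> \<nu>" for \<pi>
    using ext_integral_add[OF transport_plan_fst(1)[OF \<pi> assms] transport_plan_cost[OF \<pi>]]
    by (simp add: transport_plan_fst(2)[OF \<pi> assms] case_prod_unfold)
  then have "(INF \<pi>\<in>transport_plans \<mu> \<nu>. ext_integral \<pi> (\<lambda>(x, y). \<phi> x + c (x, y))) =
      (INF \<pi>\<in>transport_plans \<mu> \<nu>. ereal (\<integral>x. \<phi> x \<partial>\<mu>) + ext_integral \<pi> c)"
    by (intro INF_cong) auto
  also have "\<dots> = ereal (\<integral>x. \<phi> x \<partial>\<mu>) + transport_cost c \<mu> \<nu>"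
    unfolding transport_cost_def by (rule INF_ereal_const_add)
  finally show ?thesis
    unfolding solves_K_minus_def by (simp only: ereal_diff_eq_iff)
qed

text \<open>Writing the integrand as \<open>- (- \<psi> + c)\<close> turns the supremum into minus
  an infimum, to which the argument for (K^-) applies.\<close>

lemma solves_K_plus_iff:
  assumes "integrable \<nu> \<psi>"
  shows "solves_K_plus c \<mu> \<nu> \<psi> \<longleftrightarrow>
    ereal ((\<integral>y. \<psi> y \<partial>\<nu>) - (\<integral>x. T_plus c \<psi> x \<partial>\<mu>)) = transport_cost c \<mu> \<nu>"
proof -
  have "ext_integral \<pi> (\<lambda>(x, y). \<psi> y - c (x, y)) = - (ereal (- (\<integral>y. \<psi> y \<partial>\<nu>)) + ext_integral \<pi> c)"
    if \<pi>: "\<pi> \<in> transport_plans \<mu> \<nu>" for \<pi>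
  proof -
    note \<psi> = transport_plan_snd[OF \<pi> assms]
    note C = transport_plan_cost[OF \<pi>]
    have "ext_integral \<pi> (\<lambda>z. - (- \<psi> (snd z) + c z)) = - ext_integral \<pi> (\<lambda>z. - \<psi> (snd z) + c z)"
    proof (rule ext_integral_uminus)
      have m [measurable]: "c \<in> borel_measurable \<pi>" "(\<lambda>z. \<psi> (snd z)) \<in> borel_measurable \<pi>"
        using C(1) \<psi>(1) by auto
      \<comment> \<open>The negative part of \<open>- \<psi> + c\<close> is controlled by the
        positive part of \<psi> and the negative part of \<open>c\<close>, both of finite
        integral.\<close>
      have "(\<integral>\<^sup>+ z. ennreal (- (- \<psi> (snd z) + c z)) \<partial>\<pi>)
          \<le> (\<integral>\<^sup>+ z. ennreal (\<psi> (snd z)) + ennreal (- c z) \<partial>\<pi>)"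
        by (intro nn_integral_mono) (auto simp: ennreal_plus_if intro: ennreal_leI)
      also have "\<dots> = (\<integral>\<^sup>+ z. ennreal (\<psi> (snd z)) \<partial>\<pi>) + (\<integral>\<^sup>+ z. ennreal (- c z) \<partial>\<pi>)"
        by (rule nn_integral_add) auto
      finally show "(\<integral>\<^sup>+ z. ennreal (- (- \<psi> (snd z) + c z)) \<partial>\<pi>) \<noteq> \<infinity>"
        using C(2) \<psi>(1) by (auto simp: top_unique real_integrable_def)
    qed
    then show ?thesis
      using ext_integral_add[of \<pi> "\<lambda>z. - \<psi> (snd z)", OF _ C] \<psi> by (simp add: case_prod_unfold)
  qed
  then have "(SUP \<pi>\<in>transport_plans \<mu> \<nu>. ext_integral \<pi> (\<lambda>(x, y). \<psi> y - c (x, y))) =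
      (SUP \<pi>\<in>transport_plans \<mu> \<nu>. - (ereal (- (\<integral>y. \<psi> y \<partial>\<nu>)) + ext_integral \<pi> c))"
    by (intro SUP_cong) auto
  also have "\<dots> = - (ereal (- (\<integral>y. \<psi> y \<partial>\<nu>)) + transport_cost c \<mu> \<nu>)"
    unfolding ereal_SUP_uminus_eq transport_cost_def by (simp only: INF_ereal_const_add)
  also have "\<dots> = ereal (\<integral>y. \<psi> y \<partial>\<nu>) - transport_cost c \<mu> \<nu>"
    by (cases "transport_cost c \<mu> \<nu>") auto
  finally show ?thesis
    unfolding solves_K_plus_def by (simp only: ereal_eq_diff_iff)
qed

end

theorem theorem4p2:
  fixes c :: "'a::polish_space \<times> 'b::polish_space \<Rightarrow> real"
    and \<mu> :: "'a measure" and \<nu> :: "'b measure"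
  assumes "c \<in> borel_measurable borel"
    and "\<exists>K. \<forall>x y. K \<le> c (x, y)"
    and "prob_space \<mu>" "sets \<mu> = sets borel"
    and "prob_space \<nu>" "sets \<nu> = sets borel"
  shows
    "(\<forall>\<phi>. T_minus_attained c \<phi> \<and> integrable \<mu> \<phi> \<and> integrable \<nu> (T_minus c \<phi>) \<longrightarrow>
        (solves_K_minus c \<mu> \<nu> \<phi> \<longrightarrow> solves_KR c \<mu> \<nu> \<phi> (T_minus c \<phi>)) \<and>
        (\<forall>\<psi>. solves_KR c \<mu> \<nu> \<phi> \<psi> \<longrightarrow> solves_K_minus c \<mu> \<nu> \<phi>)) \<and>
     (\<forall>\<psi>. T_plus_attained c \<psi> \<and> integrable \<nu> \<psi> \<and> integrable \<mu> (T_plus c \<psi>) \<longrightarrow>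
        (solves_K_plus c \<mu> \<nu> \<psi> \<longrightarrow> solves_KR c \<mu> \<nu> (T_plus c \<psi>) \<psi>) \<and>
        (\<forall>\<phi>. solves_KR c \<mu> \<nu> \<phi> \<psi> \<longrightarrow> solves_K_plus c \<mu> \<nu> \<psi>))"
proof -
  from assms(2) obtain K where "\<And>z. K \<le> c z" by auto
  note iff = solves_K_minus_iff[OF assms(1) this] solves_K_plus_iff[OF assms(1) this]
  have "solves_K_minus c \<mu> \<nu> \<phi>"
    if "T_minus_attained c \<phi>" "integrable \<nu> (T_minus c \<phi>)" "solves_KR c \<mu> \<nu> \<phi> \<psi>" for \<phi> \<psi>
  proof -
    have KR: "(\<phi>, \<psi>) \<in> I_c c" "integrable \<mu> \<phi>" "integrable \<nu> \<psi>"
      "ereal ((\<integral>y. \<psi> y \<partial>\<nu>) - (\<integral>x. \<phi> x \<partial>\<mu>)) = transport_cost c \<mu> \<nu>"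
      using that(3) by (auto simp: solves_KR_iff)
    \<comment> \<open>Passing from \<psi> to its largest replacement cannot lower a dual value that
      already equals the cost, and weak duality forbids raising it.\<close>
    have "(\<integral>y. \<psi> y \<partial>\<nu>) \<le> (\<integral>y. T_minus c \<phi> y \<partial>\<nu>)"
      using KR that by (intro integral_mono I_c_le_T_minus)
    then have "transport_cost c \<mu> \<nu> \<le> ereal ((\<integral>y. T_minus c \<phi> y \<partial>\<nu>) - (\<integral>x. \<phi> x \<partial>\<mu>))"
      by (simp flip: KR(4))
    moreover have "ereal ((\<integral>y. T_minus c \<phi> y \<partial>\<nu>) - (\<integral>x. \<phi> x \<partial>\<mu>)) \<le> transport_cost c \<mu> \<nu>"
      using that KR by (intro weak_duality T_minus_in_I_c)
    ultimately show ?thesis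
      by (simp add: iff(1)[OF KR(2)] antisym)
  qed
  moreover have "solves_K_plus c \<mu> \<nu> \<psi>"
    if "T_plus_attained c \<psi>" "integrable \<mu> (T_plus c \<psi>)" "solves_KR c \<mu> \<nu> \<phi> \<psi>" for \<phi> \<psi>
  proof -
    have KR: "(\<phi>, \<psi>) \<in> I_c c" "integrable \<mu> \<phi>" "integrable \<nu> \<psi>"
      "ereal ((\<integral>y. \<psi> y \<partial>\<nu>) - (\<integral>x. \<phi> x \<partial>\<mu>)) = transport_cost c \<mu> \<nu>"
      using that(3) by (auto simp: solves_KR_iff)
    \<comment> \<open>The integral over \<mu> enters the dual value with a minus sign, so here the
      smallest replacement of \<phi> is the favourable one.\<close>
    have "(\<integral>x. T_plus c \<psi> x \<partial>\<mu>) \<le> (\<integral>x. \<phi> x \<partial>\<mu>)"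
      using KR that by (intro integral_mono I_c_ge_T_plus)
    then have "transport_cost c \<mu> \<nu> \<le> ereal ((\<integral>y. \<psi> y \<partial>\<nu>) - (\<integral>x. T_plus c \<psi> x \<partial>\<mu>))"
      by (simp flip: KR(4))
    moreover have "ereal ((\<integral>y. \<psi> y \<partial>\<nu>) - (\<integral>x. T_plus c \<psi> x \<partial>\<mu>)) \<le> transport_cost c \<mu> \<nu>"
      using that KR by (intro weak_duality T_plus_in_I_c)
    ultimately show ?thesis
      by (simp add: iff(2)[OF KR(3)] antisym)
  qed
  \<comment> \<open>The forward implications remain: (K^-) and (K^+) give the optimal dual value,
    and attainment gives admissibility.\<close>
  ultimately show ?thesis
    by (auto simp: iff solves_KR_iff T_minus_in_I_c T_plus_in_I_c)
qed

end
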